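(* Let $\mu,\nu$ be probability distributions on $\mathbb R^d$ with finite mean (i.e. finite first absolute moment). Then $$d_H(\mu,\nu)=\frac{\pi^{(d-1)/4}}{\sqrt{\Gamma\left(\frac{d+1}{2}\right)}}\;\mathcal E_1(\mu,\nu).$$
   Context: $\sigma$ is the unnormalized surface measure on the unit sphere $\mathbb S^{d-1}\subset\mathbb R^d$ (counting measure on $\{\pm1\}$ if $d=1$). The average perceptron discrepancy is $$d_H(\mu,\nu)=\sqrt{\int_{\mathbb S^{d-1}}\int_{\mathbb R}\Big(\mu(\{x:\langle v,x\rangle\ge b\})-\nu(\{x:\langle v,x\rangle\ge b\})\Big)^2\,db\,d\sigma(v)} .$$ The energy distance $\mathcal E_1(\mu,\nu)\ge0$ is given by $\mathcal E_1^2(\mu,\nu)=\mathbb E\big[2\|X-Y\|-\|X-X'\|-\|Y-Y'\|\big]$ with $(X,X',Y,Y')\sim\mu^{\otimes2}\otimes\nu^{\otimes2}$. *)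

theory Defs
  imports "HOL-Probability.Probability"
begin

text \<open>
  The unnormalized surface measure on the unit sphere of a \<open>d\<close>-dimensional Euclidean space, given as
  the cone measure: a Borel set \<open>A\<close> of unit vectors receives \<open>d\<close> times the Lebesgue measure of
  \<open>{t *\<^sub>R v | 0 < t \<le> 1, v \<in> A}\<close>. This is the measure that occurs in polar coordinates
  \<open>dx = r ^ (d - 1) dr d\<sigma>(v)\<close>; recall \<open>sgn x = x /\<^sub>R norm x\<close>.
\<close>

definition sphere_measure :: "'a::euclidean_space measure" where
  "sphere_measure = scale_measure (of_nat DIM('a))
     (distr (restrict_space lborel (cball 0 1 - {0})) (restrict_space borel (sphere 0 1)) sgn)"

lemma space_sphere_measure [simp]: "space sphere_measure = sphere 0 1"
  by (simp add: sphere_measure_def space_scale_measure space_restrict_space)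

lemma sets_sphere_measure [simp, measurable_cong]:
  "sets sphere_measure = sets (restrict_space borel (sphere 0 1))"
  by (simp add: sphere_measure_def)

lemma measurable_sgn_sphere:
  "sgn \<in> restrict_space lborel (cball 0 1 - {0}) \<rightarrow>\<^sub>M
     restrict_space borel (sphere (0 :: 'a::euclidean_space) 1)"
proof (rule measurable_restrict_space2)
  show "sgn \<in> space (restrict_space lborel (cball 0 1 - {0})) \<rightarrow> sphere (0 :: 'a) 1"
    by (auto simp: space_restrict_space norm_sgn)
  show "sgn \<in> borel_measurable (restrict_space lborel (cball (0 :: 'a) 1 - {0}))"
    by (rule measurable_restrict_space1) simp
qed

lemma emeasure_sphere_measure:
  fixes A :: "'a::euclidean_space set"
  assumes "A \<in> sets sphere_measure"
  shows "emeasure sphere_measure A =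
    of_nat DIM('a) * emeasure lborel {t *\<^sub>R v | t v. 0 < t \<and> t \<le> 1 \<and> v \<in> A}"
proof -
  have A: "A \<in> sets (restrict_space borel (sphere 0 1))"
    using assms by simp
  then have "A \<subseteq> sphere 0 1"
    by (auto simp: sets_restrict_space)
  then have A1: "norm v = 1" if "v \<in> A" for v
    using that by auto
  have "sgn -` A \<inter> (cball 0 1 - {0}) = {t *\<^sub>R v | t v. 0 < t \<and> t \<le> 1 \<and> v \<in> A}" (is "?L = ?R")
  proof (intro equalityI subsetI)
    fix x assume x: "x \<in> ?L"
    then have "x = norm x *\<^sub>R sgn x" "0 < norm x" "norm x \<le> 1" "sgn x \<in> A"
      by (auto simp: sgn_div_norm)
    then show "x \<in> ?R" by blast
  next
    fix x assume "x \<in> ?R"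
    then obtain t v where tv: "x = t *\<^sub>R v" "0 < t" "t \<le> 1" "v \<in> A" by blast
    with A1[of v] have "norm x = t" "sgn x = v" by (auto simp: sgn_div_norm)
    with tv A1[of v] show "x \<in> ?L" by auto
  qed
  then show ?thesis
    using A unfolding sphere_measure_def
    by (simp add: emeasure_distr[OF measurable_sgn_sphere A] space_restrict_space)
      (subst emeasure_restrict_space, auto simp: A1 mult_le_one)
qed

lemma sphere_measure_real: "(sphere_measure :: real measure) = count_space {-1, 1}"
proof (rule measure_eqI_countable[of _ "{-1, 1}"])
  have S: "sphere 0 1 = {-1, 1 :: real}" by (auto simp: abs_real_def split: if_splits)
  have B: "{a} \<in> sets (sphere_measure :: real measure)" if "a \<in> {-1, 1}" for a
    using that by (auto simp: sets_restrict_space_iff S)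
  show sets: "sets (sphere_measure :: real measure) = Pow {-1, 1}"
  proof
    show "sets (sphere_measure :: real measure) \<subseteq> Pow {-1, 1}"
      by (metis S sets.space_closed space_sphere_measure)
    have "X \<in> sets (sphere_measure :: real measure)" if "X \<subseteq> {-1, 1}" for X
      using finite_subset[OF that] that
      by (auto simp: sets_restrict_space_iff S intro!: borel_closed finite_imp_closed)
    then show "Pow {-1, 1} \<subseteq> sets (sphere_measure :: real measure)" by auto
  qed
  show "sets (count_space {-1, 1 :: real}) = Pow {-1, 1}" by simp
  fix a :: real assume a: "a \<in> {-1, 1}"
  have "{t *\<^sub>R v | t v. 0 < t \<and> t \<le> 1 \<and> v \<in> {1 :: real}} = {0<..1}"
    "{t *\<^sub>R v | t v. 0 < t \<and> t \<le> 1 \<and> v \<in> {-1 :: real}} = {-1..<0}"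
    by (auto intro: exI[of _ "- x" for x])
  then show "emeasure sphere_measure {a} = emeasure (count_space {-1, 1}) {a}"
    using a B[OF a] by (auto simp: emeasure_sphere_measure)
qed simp

text \<open>
  Both integrals are taken in \<open>[0, \<infinity>]\<close>, and the square root is extended by \<open>\<surd>\<infinity> = \<infinity>\<close>. Hence an
  equation between the discrepancy and a real number also says that the integral is finite.
\<close>

definition perceptron_discrepancy :: "'a::euclidean_space measure \<Rightarrow> 'a measure \<Rightarrow> ereal" where
  "perceptron_discrepancy \<mu> \<nu> =
     (let I = (\<integral>\<^sup>+ v. (\<integral>\<^sup>+ b. ennreal ((measure \<mu> {x. v \<bullet> x \<ge> b} - measure \<nu> {x. v \<bullet> x \<ge> b})\<^sup>2)
                 \<partial>lborel) \<partial>sphere_measure)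
      in if I = \<infinity> then \<infinity> else ereal (sqrt (enn2real I)))"

definition energy_distance :: "'a::euclidean_space measure \<Rightarrow> 'a measure \<Rightarrow> real" where
  "energy_distance \<mu> \<nu> =
     sqrt (\<integral>(x, x', y, y'). 2 * norm (x - y) - norm (x - x') - norm (y - y')
             \<partial>(\<mu> \<Otimes>\<^sub>M \<mu> \<Otimes>\<^sub>M \<nu> \<Otimes>\<^sub>M \<nu>))"

end

theory Submission
  imports Defs
begin

text \<open>
  For a fixed direction \<open>v\<close>, write the squared difference of the half-space masses as an expectation
  over independent copies \<open>x, x' \<sim> \<mu>\<close> and \<open>y, y' \<sim> \<nu>\<close>. Integrating over the offset \<open>b\<close> turns products of
  half-line indicators into absolute values of the projections \<open>\<langle>v, x - y'\<rangle>\<close>, etc. Fubini then leaves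
  the integral of \<open>\<bar>\<langle>v, z\<rangle>\<bar>\<close> over the sphere, which is a constant times \<open>\<parallel>z\<parallel>\<close>. Both this proportionality
  and the constant come from computing the first absolute moment of \<open>\<langle>Y, z\<rangle>\<close>, \<open>Y\<close> Gaussian, in two ways:
  \<open>\<langle>Y, z\<rangle>\<close> is a one-dimensional Gaussian, and the integral factors in polar coordinates.
\<close>

section \<open>Polar coordinates\<close>

lemma nn_integral_sphere_measure:
  fixes f :: "'a::euclidean_space \<Rightarrow> ennreal"
  assumes [measurable]: "f \<in> borel_measurable borel"
  shows "(\<integral>\<^sup>+ v. f v \<partial>sphere_measure) =
    of_nat DIM('a) * (\<integral>\<^sup>+ y. f (sgn y) * indicator (cball 0 1 - {0}) y \<partial>lborel)"
proof -
  have f: "f \<in> borel_measurable (restrict_space borel (sphere 0 1))"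
    by (rule measurable_restrict_space1) simp
  then show ?thesis
    unfolding sphere_measure_def
    by (simp add: nn_integral_scale_measure nn_integral_distr[OF measurable_sgn_sphere]
        nn_integral_restrict_space)
qed

text \<open>The total mass is \<open>DIM('a)\<close> times the volume of the punctured unit ball.
  Finiteness bounds the integral of a linear functional over the sphere and makes Fubini available
  for the directions.\<close>

lemma finite_measure_sphere_measure: "finite_measure (sphere_measure :: 'a::euclidean_space measure)"
proof
  have "emeasure lborel (cball 0 1 - {0::'a}) \<le> emeasure lborel (cball (0::'a) 1)"
    by (intro emeasure_mono) auto
  also have "\<dots> < \<infinity>" by (rule emeasure_bounded_finite) simp
  finally have "of_nat DIM('a) * emeasure lborel (cball 0 1 - {0::'a}) \<noteq> \<infinity>"
    by (simp add: ennreal_mult_eq_top_iff)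
  moreover have "emeasure (sphere_measure :: 'a measure) (sphere 0 1) =
      of_nat DIM('a) * emeasure lborel (cball 0 1 - {0::'a})"
    using nn_integral_sphere_measure[of "\<lambda>_::'a. 1"] by simp
  ultimately show "emeasure (sphere_measure :: 'a measure) (space sphere_measure) \<noteq> \<infinity>"
    by simp
qed

lemma nn_integral_lborel_scaleR:
  fixes f :: "'a::euclidean_space \<Rightarrow> ennreal"
  assumes [measurable]: "f \<in> borel_measurable borel" and "r > 0"
  shows "(\<integral>\<^sup>+ y. f y \<partial>lborel) = ennreal (r ^ DIM('a)) * (\<integral>\<^sup>+ y. f (r *\<^sub>R y) \<partial>lborel)"
proof -
  have "(\<integral>\<^sup>+ y. f y \<partial>lborel) =
    (\<integral>\<^sup>+ y. f y \<partial>density (distr lborel borel (\<lambda>x. 0 + r *\<^sub>R x)) (\<lambda>_. \<bar>r\<bar> ^ DIM('a)))"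
    using \<open>r > 0\<close> by (subst lborel_affine[of r 0]) auto
  also have "\<dots> = ennreal (r ^ DIM('a)) * (\<integral>\<^sup>+ y. f (r *\<^sub>R y) \<partial>lborel)"
    using \<open>r > 0\<close> by (simp add: nn_integral_density nn_integral_distr nn_integral_cmult)
  finally show ?thesis .
qed

text \<open>\<open>sgn\<close> is invariant under positive scaling, so a ball of radius
  \<open>r\<close> reduces to the unit ball at the cost of the Jacobian \<open>r ^ DIM('a)\<close>.
  As a function of \<open>r\<close>, this is the distribution function of \<open>norm\<close> under
  the measure with density \<open>f (sgn y)\<close>.\<close>

lemma nn_integral_sgn_cball:
  fixes f :: "'a::euclidean_space \<Rightarrow> ennreal"
  assumes [measurable]: "f \<in> borel_measurable borel"
  shows "of_nat DIM('a) * (\<integral>\<^sup>+ y. f (sgn y) * indicator {y. norm y \<le> r} y \<partial>lborel) =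
    ennreal (if r \<ge> 0 then r ^ DIM('a) else 0) * (\<integral>\<^sup>+ v. f v \<partial>sphere_measure)"
proof (cases "r > 0")
  case True
  have "(\<integral>\<^sup>+ y. f (sgn y) * indicator {y. norm y \<le> r} y \<partial>lborel) =
     ennreal (r ^ DIM('a)) * (\<integral>\<^sup>+ y. f (sgn (r *\<^sub>R y)) * indicator {y. norm y \<le> r} (r *\<^sub>R y) \<partial>lborel)"
    using True by (intro nn_integral_lborel_scaleR) auto
  also have "(\<integral>\<^sup>+ y. f (sgn (r *\<^sub>R y)) * indicator {y. norm y \<le> r} (r *\<^sub>R y) \<partial>lborel) =
      (\<integral>\<^sup>+ y. f (sgn y) * indicator (cball 0 1 - {0}) y \<partial>lborel)"
  \<comment> \<open>The two regions differ only at the origin, which the cone measure leaves out and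
    which is a null set.\<close>
  proof (rule nn_integral_cong_AE, use AE_lborel_singleton[of 0] in eventually_elim)
    case (elim y)
    have "norm (r *\<^sub>R y) \<le> r \<longleftrightarrow> norm y \<le> 1"
      using True by simp
    with True elim show ?case
      by (simp add: sgn_scaleR indicator_def)
  qed
  finally show ?thesis
    using True by (simp add: nn_integral_sphere_measure mult_ac)
next
  \<comment> \<open>This includes \<open>r = 0\<close>: the region is then \<open>{0}\<close>, a
    null set, and the right side vanishes because the dimension is positive.\<close>
  case False
  have "(\<integral>\<^sup>+ y. f (sgn y) * indicator {y. norm y \<le> r} y \<partial>lborel) = (\<integral>\<^sup>+ y. 0 \<partial>(lborel :: 'a measure))"
  proof (rule nn_integral_cong_AE, use AE_lborel_singleton[of 0] in eventually_elim)
    case (elim y)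
    then have "\<not> norm y \<le> r"
      using False norm_le_zero_iff[of y] by linarith
    then show ?case by simp
  qed
  then show ?thesis
    using False by (simp add: zero_power)
qed

text \<open>The push-forward under \<open>norm\<close> of the measure with density
  \<open>f (sgn y)\<close> is compared with the radial measure of density proportional to
  \<open>r ^ (d - 1)\<close>. They agree on the half-lines \<open>{..r}\<close>, which are stable
  under intersection and generate the Borel sets, so they are equal. Finiteness of the spherical
  integral makes these half-lines of finite mass, as uniqueness requires.\<close>

lemma nn_integral_polar:
  fixes f :: "'a::euclidean_space \<Rightarrow> ennreal" and g :: "real \<Rightarrow> ennreal"
  assumes [measurable]: "f \<in> borel_measurable borel" "g \<in> borel_measurable borel"
    and fin: "(\<integral>\<^sup>+ v. f v \<partial>sphere_measure) < \<infinity>"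
  shows "(\<integral>\<^sup>+ y. f (sgn y) * g (norm y) \<partial>lborel) =
    (\<integral>\<^sup>+ v. f v \<partial>sphere_measure) * (\<integral>\<^sup>+ r. ennreal (r ^ (DIM('a) - 1)) * indicator {0..} r * g r \<partial>lborel)"
proof -
  define I where "I = (\<integral>\<^sup>+ v. f v \<partial>sphere_measure)"
  let ?d = "DIM('a)"
  let ?M = "distr (density lborel (\<lambda>y. f (sgn y))) borel norm"
  let ?N = "density lborel (\<lambda>r. I * (ennreal (r ^ (?d - 1)) * indicator {0..} r))"
  \<comment> \<open>Both distribution functions are computed with an extra factor \<open>d\<close>,
    which avoids a division in \<open>ennreal\<close>; it is cancelled in \<open>eq\<close>.\<close>
  have em: "of_nat ?d * emeasure ?M {..r} = ennreal (if r \<ge> 0 then r ^ ?d else 0) * I" for r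
    using nn_integral_sgn_cball[of f r]
    by (simp add: emeasure_distr emeasure_density I_def vimage_def)
  have en: "of_nat ?d * emeasure ?N {..r} = ennreal (if r \<ge> 0 then r ^ ?d else 0) * I" for r
  proof (cases "r \<ge> 0")
    case True
    have "emeasure ?N {..r} = I * (\<integral>\<^sup>+ x. ennreal (x ^ (?d - 1)) * indicator {0..r} x \<partial>lborel)"
      by (subst emeasure_density) (auto simp flip: nn_integral_cmult intro!: nn_integral_cong
          simp: mult_ac split: split_indicator)
    also have "(\<integral>\<^sup>+ x. ennreal (x ^ (?d - 1)) * indicator {0..r} x \<partial>lborel) = ennreal (r ^ ?d / ?d - 0 ^ ?d / ?d)"
      using True by (intro nn_integral_FTC_Icc) (auto intro!: derivative_eq_intros)
    finally have "of_nat ?d * emeasure ?N {..r} = I * (ennreal (real ?d) * ennreal (r ^ ?d / ?d))"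
      by (simp add: mult_ac zero_power ennreal_of_nat_eq_real_of_nat)
    also have "ennreal (real ?d) * ennreal (r ^ ?d / ?d) = ennreal (r ^ ?d)"
      using True by (subst ennreal_mult[symmetric]) auto
    finally show ?thesis using True by (simp add: mult_ac)
  next
    case False
    have "emeasure ?N {..r} = (\<integral>\<^sup>+ x. 0 \<partial>(lborel :: real measure))"
      using False by (subst emeasure_density)
        (auto intro!: nn_integral_cong simp: indicator_def simp del: nn_integral_const)
    then show ?thesis using False by simp
  qed
  have eq: "emeasure ?M {..r} = emeasure ?N {..r}" for r
  proof -
    have "of_nat ?d * emeasure ?M {..r} = of_nat ?d * emeasure ?N {..r}"
      by (simp only: em en)
    then show ?thesis
      unfolding ennreal_mult_cancel_left by simp
  qed
  have MN: "?M = ?N"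
  proof (rule measure_eqI_generator_eq[where \<Omega>=UNIV and A="\<lambda>i. {..real i}"])
    show "Int_stable (range (\<lambda>a::real. {..a}))"
      by (auto simp: Int_stable_def)
    show "emeasure ?M X = emeasure ?N X" if "X \<in> range (\<lambda>a::real. {..a})" for X
      using that eq by auto
    show "(\<Union>i. {..real i}) = UNIV"
      using real_arch_simple by auto
    show "emeasure ?M {..real i} \<noteq> \<infinity>" for i
    proof
      assume "emeasure ?M {..real i} = \<infinity>"
      then have "ennreal (real i ^ ?d) * I = \<infinity>"
        using em[of "real i"] by (simp add: ennreal_mult_top)
      then show False using fin by (auto simp: I_def ennreal_mult_eq_top_iff)
    qed
  qed (auto simp: borel_eq_atMost)
  have "(\<integral>\<^sup>+ y. f (sgn y) * g (norm y) \<partial>lborel) = (\<integral>\<^sup>+ r. g r \<partial>?M)"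
    by (simp add: nn_integral_distr nn_integral_density)
  also have "\<dots> = I * (\<integral>\<^sup>+ r. ennreal (r ^ (DIM('a) - 1)) * indicator {0..} r * g r \<partial>lborel)"
    unfolding MN by (simp add: nn_integral_density mult_ac flip: nn_integral_cmult)
  finally show ?thesis unfolding I_def .
qed

section \<open>The absolute moment of a linear functional on the sphere\<close>

text \<open>Induction by the functional equation of Gamma, starting from its value
  \<open>sqrt pi\<close> at 1/2. The factorial form is the one in which the even Gaussian moments
  are stated.\<close>

lemma Gamma_nat_plus_half:
  "Gamma (real k + 1 / 2) = sqrt pi * (fact (2 * k) / (2 ^ (2 * k) * fact k))"
proof (induction k)
  case (Suc k)
  have "Gamma (real (Suc k) + 1 / 2) = (real k + 1/2) * Gamma (real k + 1 / 2)"
    using Gamma_plus1[of "real k + 1/2"] nonpos_Ints_nonpos[of "real k + 1/2"]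
    by (force simp: algebra_simps)
  then have "Gamma (real (Suc k) + 1 / 2) =
      (real k + 1/2) * (sqrt pi * (fact (2 * k) / (2 ^ (2 * k) * fact k)))"
    by (simp only: Suc.IH)
  moreover have "fact (2 * Suc k) / (2 ^ (2 * Suc k) * fact (Suc k)) =
      (real k + 1 / 2) * (fact (2 * k) / (2 ^ (2 * k) * fact k))"
  proof -
    have "fact (2 * Suc k) = 4 * (real k + 1) * (real k + 1 / 2) * fact (2 * k)"
      by (simp add: algebra_simps)
    then show ?thesis
      by (simp add: divide_simps del: fact_Suc add: fact_Suc[of k])
  qed
  ultimately show ?case by simp
qed (simp add: Gamma_one_half_real)

text \<open>Even and odd moments have different closed forms; half-integer and integer values of
  Gamma unite them, so that no later argument depends on the parity of the dimension.\<close>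

lemma nn_integral_gaussian_moment:
  "(\<integral>\<^sup>+ r. ennreal (r ^ n) * indicator {0..} r * ennreal (exp (- r\<^sup>2)) \<partial>lborel) =
     ennreal (Gamma ((real n + 1) / 2) / 2)"
proof -
  have "has_bochner_integral lborel (\<lambda>r. indicator {0..} r *\<^sub>R (exp (- r\<^sup>2) * r ^ n)) (Gamma ((real n + 1) / 2) / 2)"
  proof (cases "even n")
    case True
    then obtain k where n: "n = 2 * k" by (elim evenE)
    have "(real n + 1) / 2 = real k + 1 / 2" by (simp add: n field_simps)
    then show ?thesis
      using gaussian_moment_even_pos[of k] by (simp only: Gamma_nat_plus_half n) (simp add: mult_ac)
  next
    case False
    then obtain k where n: "n = 2 * k + 1" by (elim oddE)
    have "(real n + 1) / 2 = 1 + real k" by (simp add: n field_simps)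
    then show ?thesis
      using gaussian_moment_odd_pos[of k] by (simp only: Gamma_fact n)
  qed
  then have "(\<integral>\<^sup>+ r. ennreal (indicator {0..} r *\<^sub>R (exp (- r\<^sup>2) * r ^ n)) \<partial>lborel) =
      ennreal (Gamma ((real n + 1) / 2) / 2)"
    by (subst nn_integral_eq_integral) (auto simp: has_bochner_integral_iff indicator_def)
  moreover have "ennreal (r ^ n) * indicator {0..} r * ennreal (exp (- r\<^sup>2)) =
      ennreal (indicator {0..} r *\<^sub>R (exp (- r\<^sup>2) * r ^ n))" for r
    by (simp add: indicator_def ennreal_mult mult.commute)
  ultimately show ?thesis by simp
qed

text \<open>The variance is \<open>1 / 2\<close>, so that the density is a multiple of \<open>exp (- (norm y)\<^sup>2)\<close>.\<close>

definition gaussian :: "'a::euclidean_space measure" where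
  "gaussian = density lborel (\<lambda>y. \<Prod>b\<in>Basis. ennreal (normal_density 0 (1 / sqrt 2) (y \<bullet> b)))"

section \<open>Independent normal coordinates and linear functionals of the Gaussian\<close>

lemma emeasure_gaussian_box:
  assumes [measurable]: "\<And>b. b \<in> Basis \<Longrightarrow> A b \<in> sets borel"
  shows "emeasure gaussian {y::'a::euclidean_space. \<forall>b\<in>Basis. y \<bullet> b \<in> A b} =
    (\<Prod>b\<in>Basis. emeasure (density lborel (normal_density 0 (1 / sqrt 2))) (A b))"
proof -
  have *: "indicator {y. \<forall>b\<in>Basis. y \<bullet> b \<in> A b} y = (\<Prod>b\<in>Basis. indicator (A b) (y \<bullet> b) :: ennreal)" for y :: 'a
    by (auto simp: indicator_def prod_zero_iff)
  have "emeasure gaussian {y::'a. \<forall>b\<in>Basis. y \<bullet> b \<in> A b} =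
      (\<integral>\<^sup>+ y. (\<Prod>b\<in>Basis. ennreal (normal_density 0 (1 / sqrt 2) (y \<bullet> b)) * indicator (A b) (y \<bullet> b)) \<partial>(lborel :: 'a measure))"
    unfolding gaussian_def by (subst emeasure_density) (simp_all add: * prod.distrib)
  also have "\<dots> = (\<Prod>b\<in>Basis. emeasure (density lborel (normal_density 0 (1 / sqrt 2))) (A b))"
    by (subst nn_integral_lborel_prod) (auto simp: emeasure_density)
  finally show ?thesis .
qed

lemma prob_space_gaussian: "prob_space (gaussian :: 'a::euclidean_space measure)"
proof -
  interpret N: prob_space "density lborel (normal_density 0 (1 / sqrt 2))"
    by (rule prob_space_normal_density) simp
  show ?thesis
    using emeasure_gaussian_box[where 'a='a, of "\<lambda>_. UNIV"] N.emeasure_space_1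
    by (intro prob_spaceI) (simp add: gaussian_def)
qed

lemma sets_gaussian [simp, measurable_cong]: "sets gaussian = sets borel"
  and space_gaussian [simp]: "space gaussian = UNIV"
  by (simp_all add: gaussian_def)

text \<open>A measure on the product space is determined by its values on boxes, where the Gaussian
  factorises. Both the marginals and the independence of the coordinates are read off from
  this.\<close>

lemma gaussian_coordinates:
  "distr (gaussian :: 'a::euclidean_space measure) (\<Pi>\<^sub>M b\<in>Basis. borel) (\<lambda>y. \<lambda>b\<in>Basis. y \<bullet> b) =
    (\<Pi>\<^sub>M b\<in>Basis. density lborel (normal_density 0 (1 / sqrt 2)))"
proof -
  interpret N: prob_space "density lborel (normal_density 0 (1 / sqrt 2))"
    by (rule prob_space_normal_density) simp
  interpret product_sigma_finite "\<lambda>_. density lborel (normal_density 0 (1 / sqrt 2))"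
    by standard
  have [measurable]: "(\<lambda>y. \<lambda>b\<in>Basis. y \<bullet> b) \<in> (gaussian :: 'a measure) \<rightarrow>\<^sub>M (\<Pi>\<^sub>M b\<in>Basis. borel)"
    by measurable
  show ?thesis
  proof (rule PiM_eqI)
    fix A assume A: "\<And>b::'a. b \<in> Basis \<Longrightarrow> A b \<in> sets (density lborel (normal_density 0 (1 / sqrt 2)))"
    then have [measurable]: "(\<Pi>\<^sub>E b\<in>Basis. A b) \<in> sets (\<Pi>\<^sub>M b\<in>(Basis::'a set). borel :: real measure)"
      by (intro sets_PiM_I_finite) auto
    have "(\<lambda>y. \<lambda>b\<in>Basis. y \<bullet> b) -` (\<Pi>\<^sub>E b\<in>Basis. A b) = {y::'a. \<forall>b\<in>Basis. y \<bullet> b \<in> A b}"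
      by (auto simp: PiE_def Pi_def)
    then show "emeasure (distr (gaussian :: 'a measure) (\<Pi>\<^sub>M b\<in>Basis. borel) (\<lambda>y. \<lambda>b\<in>Basis. y \<bullet> b)) (\<Pi>\<^sub>E b\<in>Basis. A b) =
        (\<Prod>b\<in>Basis. emeasure (density lborel (normal_density 0 (1 / sqrt 2))) (A b))"
      using A by (simp add: emeasure_distr emeasure_gaussian_box)
  qed (auto intro!: sets_PiM_cong)
qed

lemma gaussian_coordinate:
  assumes "b \<in> (Basis :: 'a::euclidean_space set)"
  shows "distributed gaussian lborel (\<lambda>y. y \<bullet> b) (normal_density 0 (1 / sqrt 2))"
proof -
  let ?N = "density lborel (normal_density 0 (1 / sqrt 2))"
  have "distr gaussian borel (\<lambda>y. y \<bullet> b) =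
     distr (distr (gaussian :: 'a measure) (\<Pi>\<^sub>M b\<in>Basis. borel) (\<lambda>y. \<lambda>b\<in>Basis. y \<bullet> b)) borel (\<lambda>f. f b)"
    using assms by (subst distr_distr) (auto simp: o_def)
  also have "\<dots> = distr (\<Pi>\<^sub>M b\<in>(Basis :: 'a set). ?N) ?N (\<lambda>f. f b)"
    unfolding gaussian_coordinates by (intro distr_cong) auto
  also have "\<dots> = ?N"
    using assms by (intro distr_PiM_component prob_space_normal_density) auto
  finally show ?thesis
    by (simp add: distributed_def cong: distr_cong)
qed

lemma indep_vars_gaussian:
  "prob_space.indep_vars gaussian (\<lambda>_. borel) (\<lambda>b y. y \<bullet> b) (Basis :: 'a::euclidean_space set)"
proof -
  interpret prob_space "gaussian :: 'a measure" by (rule prob_space_gaussian)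
  have "distr gaussian borel (\<lambda>y. y \<bullet> b) = density lborel (normal_density 0 (1 / sqrt 2))"
    if "b \<in> Basis" for b :: 'a
    using gaussian_coordinate[OF that] by (simp add: distributed_def cong: distr_cong)
  then show ?thesis
    by (subst indep_vars_iff_distr_eq_PiM')
       (auto simp: gaussian_coordinates intro!: PiM_cong)
qed

text \<open>\<open>y \<bullet> x\<close> is a sum of independent centred normals with variances
  \<open>(x \<bullet> b)\<^sup>2 / 2\<close>, hence normal with standard deviation
  \<open>s = norm x / sqrt 2\<close>; its first absolute moment is
  \<open>s * sqrt (2 / pi)\<close>.\<close>

lemma gaussian_abs_inner:
  fixes x :: "'a::euclidean_space"
  shows "(\<integral>\<^sup>+ y. ennreal \<bar>y \<bullet> x\<bar> \<partial>gaussian) = ennreal (norm x / sqrt pi)"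
proof (cases "x = 0")
  case False
  interpret prob_space "gaussian :: 'a measure" by (rule prob_space_gaussian)
  \<comment> \<open>Zero coefficients are dropped since the corresponding summand would be constant
    and have no normal density.\<close>
  let ?B = "{b \<in> Basis. x \<bullet> b \<noteq> 0}" and ?s = "norm x / sqrt 2"
  have B: "?B \<noteq> {}" using False by (auto simp: euclidean_eq_iff[of x 0])
  have s: "?s > 0" using False by simp
  have "distributed gaussian lborel (\<lambda>y. \<Sum>b\<in>?B. (x \<bullet> b) * (y \<bullet> b))
     (normal_density (\<Sum>b\<in>?B. 0) (sqrt (\<Sum>b\<in>?B. (\<bar>x \<bullet> b\<bar> * (1 / sqrt 2))\<^sup>2)))"
  proof (rule sum_indep_normal)
    have "indep_vars (\<lambda>_. borel) (\<lambda>b y. y \<bullet> b) ?B"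
      by (rule indep_vars_subset[OF indep_vars_gaussian]) auto
    then show "indep_vars (\<lambda>_. borel) (\<lambda>b y. (x \<bullet> b) * (y \<bullet> b)) ?B"
      by (rule indep_vars_compose2) simp
    fix b assume b: "b \<in> ?B"
    with normal_density_affine[of "\<lambda>y. y \<bullet> b" 0 "1 / sqrt 2" "x \<bullet> b" 0] gaussian_coordinate[of b]
    show "distributed gaussian lborel (\<lambda>y. (x \<bullet> b) * (y \<bullet> b)) (normal_density 0 (\<bar>x \<bullet> b\<bar> * (1 / sqrt 2)))"
      by simp
  qed (use B in auto)
  moreover have "(\<Sum>b\<in>?B. (x \<bullet> b) * (y \<bullet> b)) = y \<bullet> x" for y
    by (subst euclidean_inner) (auto intro!: sum.mono_neutral_cong_left simp: mult.commute)
  moreover have "(\<Sum>b\<in>?B. (\<bar>x \<bullet> b\<bar> * (1 / sqrt 2))\<^sup>2) = ?s\<^sup>2"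
  proof -
    have "(\<Sum>b\<in>?B. (\<bar>x \<bullet> b\<bar> * (1 / sqrt 2))\<^sup>2) = (\<Sum>b\<in>Basis. (x \<bullet> b) * (x \<bullet> b) / 2)"
      by (intro sum.mono_neutral_cong_left) (auto simp: power_mult_distrib power_divide power2_eq_square)
    also have "\<dots> = ?s\<^sup>2"
      by (simp add: sum_divide_distrib[symmetric] power_divide euclidean_inner[symmetric] power2_norm_eq_inner)
    finally show ?thesis .
  qed
  ultimately have D: "distributed gaussian lborel (\<lambda>y. y \<bullet> x) (normal_density 0 ?s)"
    by simp
  have "(\<integral>\<^sup>+ y. ennreal \<bar>y \<bullet> x\<bar> \<partial>gaussian) = (\<integral>\<^sup>+ t. ennreal (normal_density 0 ?s t * \<bar>t\<bar>) \<partial>lborel)"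
    using distributed_nn_integral[OF D, of "\<lambda>t. ennreal \<bar>t\<bar>"] by (simp add: ennreal_mult)
  also have "\<dots> = ennreal (?s * sqrt (2 / pi))"
    using normal_moment_abs_odd[OF s, of 0 0]
    by (subst nn_integral_eq_integral) (auto simp: has_bochner_integral_iff)
  finally show ?thesis by (simp add: real_sqrt_divide)
qed simp

lemma gaussian_density_eq:
  "(\<Prod>b\<in>Basis. ennreal (normal_density 0 (1 / sqrt 2) (y \<bullet> b))) =
    ennreal (pi powr (- (real DIM('a) / 2)) * exp (- (norm y)\<^sup>2))" for y :: "'a::euclidean_space"
proof -
  have "normal_density 0 (1 / sqrt 2) t = exp (- t\<^sup>2) / sqrt pi" for t
    by (simp add: normal_density_def power_divide)
  moreover have "(norm y)\<^sup>2 = (\<Sum>b\<in>Basis. (y \<bullet> b)\<^sup>2)"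
    unfolding power2_norm_eq_inner by (subst euclidean_inner) (simp add: power2_eq_square)
  moreover have "sqrt pi ^ DIM('a) = pi powr (real DIM('a) / 2)"
    by (simp add: powr_half_sqrt[symmetric] powr_realpow[symmetric] powr_powr)
  ultimately have "(\<Prod>b\<in>Basis. normal_density 0 (1 / sqrt 2) (y \<bullet> b)) =
      exp (- (norm y)\<^sup>2) / pi powr (real DIM('a) / 2)"
    by (simp add: prod_dividef exp_sum[symmetric] sum_negf[symmetric])
  then show ?thesis
    by (simp add: prod_ennreal powr_minus_divide)
qed

section \<open>The integral of a linear functional's absolute value over the sphere\<close>

text \<open>Twice the volume of the unit ball of dimension \<open>d - 1\<close>: projecting the
  sphere orthogonally onto a hyperplane covers that ball twice.\<close>

definition sphere_const :: "nat \<Rightarrow> real" where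
  "sphere_const d = 2 * pi powr ((real d - 1) / 2) / Gamma ((real d + 1) / 2)"

lemma sphere_const_nonneg: "0 \<le> sphere_const d"
  unfolding sphere_const_def
  by (intro divide_nonneg_pos mult_nonneg_nonneg Gamma_real_pos) auto

text \<open>The Gaussian moment of \<open>gaussian_abs_inner\<close> is computed again in polar
  coordinates. There it is the unknown spherical integral times an explicit radial moment, and
  solving for the unknown gives the constant.\<close>

lemma nn_integral_sphere_abs_inner:
  fixes x :: "'a::euclidean_space"
  shows "(\<integral>\<^sup>+ v. ennreal \<bar>v \<bullet> x\<bar> \<partial>sphere_measure) =
    ennreal (sphere_const DIM('a) * norm x)"
proof -
  let ?d = "DIM('a)" and ?I = "\<integral>\<^sup>+ v. ennreal \<bar>v \<bullet> x\<bar> \<partial>sphere_measure"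
  define G where "G = Gamma ((real ?d + 1) / 2)"
  define p where "p = pi powr (- (real ?d / 2))"
  have G: "G > 0" unfolding G_def by (intro Gamma_real_pos) auto
  have p: "p > 0" unfolding p_def by simp
  \<comment> \<open>Cauchy-Schwarz on unit vectors. Finiteness is a hypothesis of
    \<open>nn_integral_polar\<close> and later allows the equation to be solved in the
    reals.\<close>
  have "?I \<le> (\<integral>\<^sup>+ v. ennreal (norm x) \<partial>(sphere_measure :: 'a measure))"
    by (intro nn_integral_mono ennreal_leI order_trans[OF Cauchy_Schwarz_ineq2]) auto
  also have "\<dots> < \<infinity>"
    using finite_measure.emeasure_finite[OF finite_measure_sphere_measure[where 'a='a]]
    by (simp add: ennreal_mult_less_top less_top del: space_sphere_measure)
  finally have fin: "?I < \<infinity>" .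
  have "ennreal (norm x / sqrt pi) = (\<integral>\<^sup>+ y. ennreal \<bar>y \<bullet> x\<bar> \<partial>gaussian)"
    by (simp add: gaussian_abs_inner)
  \<comment> \<open>Writing \<open>y\<close> as \<open>norm y *\<^sub>R sgn y\<close> separates the
    direction from the radius. The extra factor \<open>norm y\<close> raises the radial power from
    \<open>d - 1\<close> to \<open>d\<close>, whence the argument \<open>(d + 1) / 2\<close> of
    Gamma.\<close>
  also have "\<dots> = (\<integral>\<^sup>+ y. ennreal p * (ennreal \<bar>sgn y \<bullet> x\<bar> * ennreal (norm y * exp (- (norm y)\<^sup>2))) \<partial>lborel)"
    unfolding gaussian_def gaussian_density_eq p_def[symmetric]
    using p by (subst nn_integral_density) (auto intro!: nn_integral_cong AE_I2
        simp: sgn_div_norm abs_mult field_simps simp flip: ennreal_mult)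
  also have "\<dots> = ennreal p * (\<integral>\<^sup>+ y. ennreal \<bar>sgn y \<bullet> x\<bar> * ennreal (norm y * exp (- (norm y)\<^sup>2)) \<partial>lborel)"
    by (rule nn_integral_cmult) simp
  also have "(\<integral>\<^sup>+ y. ennreal \<bar>sgn y \<bullet> x\<bar> * ennreal (norm y * exp (- (norm y)\<^sup>2)) \<partial>lborel) =
     ?I * (\<integral>\<^sup>+ r. ennreal (r ^ (?d - 1)) * indicator {0..} r * ennreal (r * exp (- r\<^sup>2)) \<partial>lborel)"
    using fin by (intro nn_integral_polar) auto
  also have "(\<integral>\<^sup>+ r. ennreal (r ^ (?d - 1)) * indicator {0..} r * ennreal (r * exp (- r\<^sup>2)) \<partial>lborel) =
     (\<integral>\<^sup>+ r. ennreal (r ^ ?d) * indicator {0..} r * ennreal (exp (- r\<^sup>2)) \<partial>lborel)"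
  proof (intro nn_integral_cong)
    fix r :: real
    have "r ^ ?d = r ^ (?d - 1) * r"
      by (metis DIM_positive Suc_diff_1 power_Suc2)
    then show "ennreal (r ^ (?d - 1)) * indicator {0..} r * ennreal (r * exp (- r\<^sup>2)) =
       ennreal (r ^ ?d) * indicator {0..} r * ennreal (exp (- r\<^sup>2))"
      by (auto simp: ennreal_mult mult_ac split: split_indicator)
  qed
  also have "\<dots> = ennreal (G / 2)"
    by (simp add: nn_integral_gaussian_moment G_def)
  finally have eq: "ennreal (norm x / sqrt pi) = ?I * ennreal (p * G / 2)"
    using p G ennreal_mult[of p "G / 2"] by (simp add: mult_ac)
  obtain i where i: "?I = ennreal i" "i \<ge> 0"
    using fin by (cases ?I) auto
  have "norm x / sqrt pi = i * (p * G / 2)"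
    using eq i p G by (simp add: ennreal_mult[symmetric])
  then have "i = 2 * (1 / (p * sqrt pi)) / G * norm x"
    using p G by (simp add: field_simps)
  also have "1 / (p * sqrt pi) = pi powr ((real ?d - 1) / 2)"
  proof -
    have "p * sqrt pi = pi powr (- (real ?d / 2) + 1 / 2)"
      unfolding p_def powr_add by (simp add: powr_half_sqrt)
    also have "- (real ?d / 2) + 1 / 2 = - ((real ?d - 1) / 2)"
      by (simp add: field_simps)
    finally show ?thesis
      by (simp add: powr_minus_divide)
  qed
  finally show ?thesis using i by (simp add: G_def sphere_const_def)
qed

lemma measurable_sphere_measure [measurable]: "(\<lambda>v. v) \<in> sphere_measure \<rightarrow>\<^sub>M (borel :: 'a::euclidean_space measure)"
  by (simp add: sphere_measure_def measurable_restrict_space1 cong: measurable_cong_sets)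

lemma has_bochner_integral_sphere_abs_inner:
  fixes x :: "'a::euclidean_space"
  shows "has_bochner_integral sphere_measure (\<lambda>v. \<bar>v \<bullet> x\<bar>)
    (sphere_const DIM('a) * norm x)"
  by (intro has_bochner_integral_nn_integral nn_integral_sphere_abs_inner)
     (auto simp: sphere_const_nonneg)

section \<open>Product measures and half-lines\<close>

lemma (in prob_space) distr_pair_snd:
  assumes "sigma_finite_measure N"
  shows "distr (M \<Otimes>\<^sub>M N) N snd = N"
proof -
  interpret N: sigma_finite_measure N by fact
  interpret pair_sigma_finite N M ..
  have "N = distr (distr (M \<Otimes>\<^sub>M N) (N \<Otimes>\<^sub>M M) (\<lambda>(x, y). (y, x))) N fst"
    using distr_pair_fst[of N] distr_pair_swap by simp
  also have "\<dots> = distr (M \<Otimes>\<^sub>M N) N snd"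
    by (subst distr_distr) (auto simp: o_def case_prod_beta')
  finally show ?thesis by simp
qed

text \<open>Lets a marginal of a nested product be taken inside the second component while the first
  is kept.\<close>

lemma distr_pair_map_snd:
  assumes "prob_space B" "f \<in> B \<rightarrow>\<^sub>M C" "distr B C f = C"
  shows "distr (A \<Otimes>\<^sub>M B) (A \<Otimes>\<^sub>M C) (\<lambda>p. (fst p, f (snd p))) = A \<Otimes>\<^sub>M C"
proof -
  interpret B: prob_space B by fact
  interpret C: prob_space C using B.prob_space_distr[OF assms(2)] assms(3) by simp
  show ?thesis
    using pair_measure_distr[of "\<lambda>x. x" A A f B C] assms C.sigma_finite_measure_axioms
    by (simp add: distr_id case_prod_beta')
qed

lemma integral_pair_indicator:
  assumes "prob_space A" "prob_space B" "S \<in> sets A" "T \<in> sets B"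
  shows "(\<integral>p. indicator S (fst p) * indicator T (snd p) \<partial>(A \<Otimes>\<^sub>M B)) = measure A S * measure B T"
proof -
  interpret B: prob_space B by fact
  have "(\<lambda>p. indicator S (fst p) * indicator T (snd p) :: real) = indicator (S \<times> T)"
    by (auto simp: indicator_def)
  moreover have "S \<times> T \<in> sets (A \<Otimes>\<^sub>M B)" using assms by simp
  ultimately show ?thesis
    using assms sets.sets_into_space[of "S \<times> T" "A \<Otimes>\<^sub>M B"]
    by (simp add: measure_def B.emeasure_pair_measure_Times enn2real_mult Int_absorb1 Int_absorb2)
qed

text \<open>In \<open>b\<close>, a single half-line indicator has infinite integral, but the
  difference is, up to sign, the indicator of the interval between \<open>a\<close> and
  \<open>c\<close>. For this reason only differences are integrated below.\<close>

lemma has_bochner_integral_half_line_diff: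
  fixes a c :: real
  shows "has_bochner_integral lborel (\<lambda>b. indicat_real {b..} a - indicat_real {b..} c) (a - c)"
proof (cases "c \<le> a")
  case True
  have "has_bochner_integral lborel (indicat_real {c<..a}) (a - c)"
    using has_bochner_integral_real_indicator[of "{c<..a}" lborel] True by simp
  also have "indicat_real {c<..a} = (\<lambda>b. indicat_real {b..} a - indicat_real {b..} c)"
    using True by (auto simp: indicator_def fun_eq_iff)
  finally show ?thesis .
next
  case False
  then have "has_bochner_integral lborel (\<lambda>b. - indicat_real {a<..c} b) (- (c - a))"
    using has_bochner_integral_real_indicator[of "{a<..c}" lborel] by (intro has_bochner_integral_minus) simp
  also have "(\<lambda>b. - indicat_real {a<..c} b) = (\<lambda>b. indicat_real {b..} a - indicat_real {b..} c)"
    using False by (auto simp: indicator_def fun_eq_iff)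
  finally show ?thesis by simp
qed

lemma has_bochner_integral_half_line_abs_diff:
  fixes a c :: real
  shows "has_bochner_integral lborel (\<lambda>b. \<bar>indicat_real {b..} a - indicat_real {b..} c\<bar>) \<bar>a - c\<bar>"
proof -
  have "(\<lambda>b. \<bar>indicat_real {b..} a - indicat_real {b..} c\<bar>) =
      (\<lambda>b. sgn (a - c) * (indicat_real {b..} a - indicat_real {b..} c))"
    \<comment> \<open>The difference never takes the sign opposite to that of \<open>a - c\<close>,
      whatever \<open>b\<close> is.\<close>
    by (auto simp: indicator_def fun_eq_iff sgn_if)
  then show ?thesis
    using has_bochner_integral_mult_right[OF has_bochner_integral_half_line_diff[of a c], of "sgn (a - c)"]
    by (simp add: abs_sgn mult.commute)
qed

lemma has_bochner_integral_half_line_diff_mult: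
  fixes a c a' c' :: real
  shows "has_bochner_integral lborel
     (\<lambda>b. (indicat_real {b..} a - indicat_real {b..} c) * (indicat_real {b..} a' - indicat_real {b..} c'))
     ((\<bar>a - c'\<bar> + \<bar>a' - c\<bar> - \<bar>a - a'\<bar> - \<bar>c - c'\<bar>) / 2)"
proof -
  \<comment> \<open>Expand the product, using that \<open>b \<le> a\<close> and \<open>b \<le> a'\<close> together mean \<open>b \<le> min a a'\<close>.\<close>
  have "has_bochner_integral lborel
     (\<lambda>b. (indicat_real {b..} (min a a') - indicat_real {b..} (min a c')) +
          (indicat_real {b..} (min c c') - indicat_real {b..} (min c a')))
     ((min a a' - min a c') + (min c c' - min c a'))"
    by (intro has_bochner_integral_add has_bochner_integral_half_line_diff)
  \<comment> \<open>Here min(s, t) = (s + t - |s - t|) / 2, and the linear terms cancel.\<close>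
  also have "(min a a' - min a c') + (min c c' - min c a') =
      (\<bar>a - c'\<bar> + \<bar>a' - c\<bar> - \<bar>a - a'\<bar> - \<bar>c - c'\<bar>) / 2"
    by (simp add: min_def)
  also have "(\<lambda>b. (indicat_real {b..} (min a a') - indicat_real {b..} (min a c')) +
          (indicat_real {b..} (min c c') - indicat_real {b..} (min c a'))) =
      (\<lambda>b. (indicat_real {b..} a - indicat_real {b..} c) * (indicat_real {b..} a' - indicat_real {b..} c'))"
    by (auto simp: indicator_def fun_eq_iff)
  finally show ?thesis .
qed

lemma integrable_pair_fst:
  fixes f :: "_ \<Rightarrow> real"
  assumes "prob_space B" "integrable A f"
  shows "integrable (A \<Otimes>\<^sub>M B) (\<lambda>p. f (fst p))"
  using assms prob_space.distr_pair_fst[of B A] integrable_distr_eq[of fst "A \<Otimes>\<^sub>M B" A f] by auto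

lemma integrable_pair_snd:
  fixes f :: "_ \<Rightarrow> real"
  assumes "prob_space A" "prob_space B" "integrable B f"
  shows "integrable (A \<Otimes>\<^sub>M B) (\<lambda>p. f (snd p))"
  using assms prob_space.distr_pair_snd[of A B] integrable_distr_eq[of snd "A \<Otimes>\<^sub>M B" B f]
  by (auto simp: prob_space_imp_sigma_finite)

section \<open>Slices of the discrepancy\<close>

locale distribution_pair = X: prob_space \<mu> + Y: prob_space \<nu>
  for \<mu> \<nu> :: "'a::euclidean_space measure" +
  assumes sets_X [simp, measurable_cong]: "sets \<mu> = sets borel"
    and sets_Y [simp, measurable_cong]: "sets \<nu> = sets borel"
    and integrable_X: "integrable \<mu> norm"
    and integrable_Y: "integrable \<nu> norm"
begin

lemma space_X [simp]: "space \<mu> = UNIV" and space_Y [simp]: "space \<nu> = UNIV"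
  using sets_eq_imp_space_eq[OF sets_X] sets_eq_imp_space_eq[OF sets_Y] by auto

abbreviation "joint \<equiv> \<mu> \<Otimes>\<^sub>M \<mu> \<Otimes>\<^sub>M \<nu> \<Otimes>\<^sub>M \<nu>"

sublocale YY: prob_space "\<nu> \<Otimes>\<^sub>M \<nu>" by (intro prob_space_pair Y.prob_space_axioms)
sublocale XYY: prob_space "\<mu> \<Otimes>\<^sub>M \<nu> \<Otimes>\<^sub>M \<nu>" by (intro prob_space_pair X.prob_space_axioms YY.prob_space_axioms)
sublocale J: prob_space joint by (intro prob_space_pair X.prob_space_axioms XYY.prob_space_axioms)

text \<open>The product is nested to the right, so each pair arises by repeatedly keeping a first
  component or discarding it. All three mixed pairs have law
  \<open>\<mu> \<Otimes>\<^sub>M \<nu>\<close>, which later makes their expected distances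
  interchangeable.\<close>

lemma distr_joint:
  shows distr_joint_xx: "distr joint (\<mu> \<Otimes>\<^sub>M \<mu>) (\<lambda>(x, x', y, y'). (x, x')) = \<mu> \<Otimes>\<^sub>M \<mu>"
    and distr_joint_xy: "distr joint (\<mu> \<Otimes>\<^sub>M \<nu>) (\<lambda>(x, x', y, y'). (x, y)) = \<mu> \<Otimes>\<^sub>M \<nu>"
    and distr_joint_xy': "distr joint (\<mu> \<Otimes>\<^sub>M \<nu>) (\<lambda>(x, x', y, y'). (x, y')) = \<mu> \<Otimes>\<^sub>M \<nu>"
    and distr_joint_x'y: "distr joint (\<mu> \<Otimes>\<^sub>M \<nu>) (\<lambda>(x, x', y, y'). (x', y)) = \<mu> \<Otimes>\<^sub>M \<nu>"
    and distr_joint_yy: "distr joint (\<nu> \<Otimes>\<^sub>M \<nu>) (\<lambda>(x, x', y, y'). (y, y')) = \<nu> \<Otimes>\<^sub>M \<nu>"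
proof -
  note snds = X.distr_pair_snd[OF XYY.sigma_finite_measure_axioms]
    X.distr_pair_snd[OF YY.sigma_finite_measure_axioms]
    Y.distr_pair_snd[OF Y.sigma_finite_measure_axioms]
  have y: "distr (\<mu> \<Otimes>\<^sub>M \<nu> \<Otimes>\<^sub>M \<nu>) \<nu> (\<lambda>p. fst (snd p)) = \<nu>"
    using Y.distr_pair_fst[of \<nu>] distr_distr[of fst "\<nu> \<Otimes>\<^sub>M \<nu>" \<nu> snd "\<mu> \<Otimes>\<^sub>M \<nu> \<Otimes>\<^sub>M \<nu>"]
    by (simp add: snds o_def)
  have y': "distr (\<mu> \<Otimes>\<^sub>M \<nu> \<Otimes>\<^sub>M \<nu>) \<nu> (\<lambda>p. snd (snd p)) = \<nu>"
    using distr_distr[of snd "\<nu> \<Otimes>\<^sub>M \<nu>" \<nu> snd "\<mu> \<Otimes>\<^sub>M \<nu> \<Otimes>\<^sub>M \<nu>"]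
    by (simp add: snds o_def)
  show "distr joint (\<mu> \<Otimes>\<^sub>M \<mu>) (\<lambda>(x, x', y, y'). (x, x')) = \<mu> \<Otimes>\<^sub>M \<mu>"
    using distr_pair_map_snd[OF XYY.prob_space_axioms measurable_fst YY.distr_pair_fst]
    by (simp add: case_prod_beta')
  show "distr joint (\<mu> \<Otimes>\<^sub>M \<nu>) (\<lambda>(x, x', y, y'). (x, y)) = \<mu> \<Otimes>\<^sub>M \<nu>"
    "distr joint (\<mu> \<Otimes>\<^sub>M \<nu>) (\<lambda>(x, x', y, y'). (x, y')) = \<mu> \<Otimes>\<^sub>M \<nu>"
    using distr_pair_map_snd[OF XYY.prob_space_axioms _ y, of \<mu>]
      distr_pair_map_snd[OF XYY.prob_space_axioms _ y', of \<mu>]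
    by (simp_all add: case_prod_beta')
  have sub: "distr joint B (\<lambda>p. g (snd p)) = B"
    if "g \<in> (\<mu> \<Otimes>\<^sub>M \<nu> \<Otimes>\<^sub>M \<nu>) \<rightarrow>\<^sub>M B" "distr (\<mu> \<Otimes>\<^sub>M \<nu> \<Otimes>\<^sub>M \<nu>) B g = B" for g and B :: "('a \<times> 'a) measure"
    using distr_distr[OF that(1), of snd joint] by (simp add: snds o_def that)
  show "distr joint (\<nu> \<Otimes>\<^sub>M \<nu>) (\<lambda>(x, x', y, y'). (y, y')) = \<nu> \<Otimes>\<^sub>M \<nu>"
    using sub[of snd "\<nu> \<Otimes>\<^sub>M \<nu>"] by (simp add: snds case_prod_beta')
  show "distr joint (\<mu> \<Otimes>\<^sub>M \<nu>) (\<lambda>(x, x', y, y'). (x', y)) = \<mu> \<Otimes>\<^sub>M \<nu>"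
    using sub[OF _ distr_pair_map_snd[OF YY.prob_space_axioms measurable_fst Y.distr_pair_fst]]
    by (simp add: case_prod_beta')
qed

lemma integral_joint:
  fixes g :: "'a \<times> 'a \<Rightarrow> real"
  assumes [measurable]: "g \<in> borel_measurable (borel \<Otimes>\<^sub>M borel)"
  shows "(\<integral>(x, x', y, y'). g (x, x') \<partial>joint) = (\<integral>p. g p \<partial>(\<mu> \<Otimes>\<^sub>M \<mu>))"
    and "(\<integral>(x, x', y, y'). g (x, y) \<partial>joint) = (\<integral>p. g p \<partial>(\<mu> \<Otimes>\<^sub>M \<nu>))"
    and "(\<integral>(x, x', y, y'). g (x, y') \<partial>joint) = (\<integral>p. g p \<partial>(\<mu> \<Otimes>\<^sub>M \<nu>))"
    and "(\<integral>(x, x', y, y'). g (x', y) \<partial>joint) = (\<integral>p. g p \<partial>(\<mu> \<Otimes>\<^sub>M \<nu>))"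
    and "(\<integral>(x, x', y, y'). g (y, y') \<partial>joint) = (\<integral>p. g p \<partial>(\<nu> \<Otimes>\<^sub>M \<nu>))"
proof -
  have *: "(\<integral>p. g (f p) \<partial>joint) = (\<integral>p. g p \<partial>N)"
    if "f \<in> joint \<rightarrow>\<^sub>M N" "distr joint N f = N" "sets N = sets (borel \<Otimes>\<^sub>M borel)" for f N
    using integral_distr[OF that(1), of g] assms that by (simp cong: measurable_cong_sets)
  show "(\<integral>(x, x', y, y'). g (x, x') \<partial>joint) = (\<integral>p. g p \<partial>(\<mu> \<Otimes>\<^sub>M \<mu>))"
    using *[OF _ distr_joint_xx] by (simp add: case_prod_beta' cong: sets_pair_measure_cong)
  show "(\<integral>(x, x', y, y'). g (x, y) \<partial>joint) = (\<integral>p. g p \<partial>(\<mu> \<Otimes>\<^sub>M \<nu>))"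
    using *[OF _ distr_joint_xy] by (simp add: case_prod_beta' cong: sets_pair_measure_cong)
  show "(\<integral>(x, x', y, y'). g (x, y') \<partial>joint) = (\<integral>p. g p \<partial>(\<mu> \<Otimes>\<^sub>M \<nu>))"
    using *[OF _ distr_joint_xy'] by (simp add: case_prod_beta' cong: sets_pair_measure_cong)
  show "(\<integral>(x, x', y, y'). g (x', y) \<partial>joint) = (\<integral>p. g p \<partial>(\<mu> \<Otimes>\<^sub>M \<nu>))"
    using *[OF _ distr_joint_x'y] by (simp add: case_prod_beta' cong: sets_pair_measure_cong)
  show "(\<integral>(x, x', y, y'). g (y, y') \<partial>joint) = (\<integral>p. g p \<partial>(\<nu> \<Otimes>\<^sub>M \<nu>))"
    using *[OF _ distr_joint_yy] by (simp add: case_prod_beta' cong: sets_pair_measure_cong)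
qed

lemma integrable_joint_norm:
  "integrable joint (\<lambda>p. norm (fst p))" "integrable joint (\<lambda>p. norm (fst (snd p)))"
  "integrable joint (\<lambda>p. norm (fst (snd (snd p))))" "integrable joint (\<lambda>p. norm (snd (snd (snd p))))"
  using integrable_X integrable_Y
  by (auto intro!: integrable_pair_fst integrable_pair_snd[where f="\<lambda>p. norm (fst p)"]
      integrable_pair_snd[where f="\<lambda>p. norm (fst (snd p))"] integrable_pair_snd[where f="\<lambda>p. norm (snd p)"]
      integrable_pair_snd[where f="\<lambda>p. norm (snd (snd p))"] integrable_pair_snd[where f=norm]
      X.prob_space_axioms Y.prob_space_axioms YY.prob_space_axioms XYY.prob_space_axioms)

text \<open>Two independent copies turn a squared expectation into the expectation of a product: the
  first factor sees only \<open>(x, y)\<close>, the second only \<open>(x', y')\<close>.\<close>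

definition slice_kernel :: "real \<Rightarrow> 'a \<Rightarrow> 'a \<times> 'a \<times> 'a \<times> 'a \<Rightarrow> real" where
  "slice_kernel b v = (\<lambda>(x, x', y, y').
     (indicator {b..} (v \<bullet> x) - indicator {b..} (v \<bullet> y)) * (indicator {b..} (v \<bullet> x') - indicator {b..} (v \<bullet> y')))"

text \<open>The product expands into four products of two half-space indicators; independence
  evaluates each as a product of masses, and these add up to the square.\<close>

lemma integral_slice_kernel:
  "(\<integral>p. slice_kernel b v p \<partial>joint) = (measure \<mu> {x. v \<bullet> x \<ge> b} - measure \<nu> {x. v \<bullet> x \<ge> b})\<^sup>2"
proof -
  let ?A = "{x. v \<bullet> x \<ge> b}"
  define g :: "'a \<times> 'a \<Rightarrow> real" where "g p = indicator ?A (fst p) * indicator ?A (snd p)" for p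
  have A [measurable]: "?A \<in> sets borel" by measurable
  have [measurable]: "g \<in> borel_measurable (borel \<Otimes>\<^sub>M borel)" unfolding g_def by measurable
  have int: "integrable joint (\<lambda>p. g (f p))" if [measurable]: "f \<in> joint \<rightarrow>\<^sub>M borel \<Otimes>\<^sub>M borel" for f
    by (rule J.integrable_const_bound[of _ 1]) (auto simp: g_def indicator_def)
  have "slice_kernel b v = (\<lambda>(x, x', y, y'). g (x, x') - g (x, y') - g (x', y) + g (y, y'))"
    by (auto simp: slice_kernel_def g_def indicator_def fun_eq_iff)
  then have "(\<integral>p. slice_kernel b v p \<partial>joint) =
      (\<integral>(x, x', y, y'). g (x, x') \<partial>joint) - (\<integral>(x, x', y, y'). g (x, y') \<partial>joint)
      - (\<integral>(x, x', y, y'). g (x', y) \<partial>joint) + (\<integral>(x, x', y, y'). g (y, y') \<partial>joint)"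
    using int[of "\<lambda>p. (fst p, fst (snd p))"] int[of "\<lambda>p. (fst p, snd (snd (snd p)))"]
      int[of "\<lambda>p. (fst (snd p), fst (snd (snd p)))"] int[of "\<lambda>p. (fst (snd (snd p)), snd (snd (snd p)))"]
    by (simp add: case_prod_beta')
  also have "\<dots> = measure \<mu> ?A * measure \<mu> ?A - measure \<mu> ?A * measure \<nu> ?A
      - measure \<mu> ?A * measure \<nu> ?A + measure \<nu> ?A * measure \<nu> ?A"
    unfolding integral_joint[OF \<open>g \<in> _\<close>] unfolding g_def
    using A by (simp add: integral_pair_indicator X.prob_space_axioms Y.prob_space_axioms)
  finally show ?thesis by (simp add: power2_eq_square algebra_simps)
qed

text \<open>Half of the energy-distance integrand for the projections onto \<open>v\<close>, with
  the cross term split over the pairs \<open>(x, y')\<close> and \<open>(x', y)\<close> as the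
  integration over \<open>b\<close> produces it.\<close>

definition projected_energy :: "'a \<Rightarrow> 'a \<times> 'a \<times> 'a \<times> 'a \<Rightarrow> real" where
  "projected_energy v = (\<lambda>(x, x', y, y').
     (\<bar>v \<bullet> (x - y')\<bar> + \<bar>v \<bullet> (x' - y)\<bar> - \<bar>v \<bullet> (x - x')\<bar> - \<bar>v \<bullet> (y - y')\<bar>) / 2)"

lemma has_bochner_integral_slice_kernel:
  "has_bochner_integral lborel (\<lambda>b. slice_kernel b v p) (projected_energy v p)"
  by (cases p) (simp add: slice_kernel_def projected_energy_def inner_diff_right
      has_bochner_integral_half_line_diff_mult)

lemma integrable_norm_diff:
  assumes "integrable joint (\<lambda>p. norm (f p))" "integrable joint (\<lambda>p. norm (g p))"
    and "f \<in> joint \<rightarrow>\<^sub>M borel" "g \<in> joint \<rightarrow>\<^sub>M borel"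
  shows "integrable joint (\<lambda>p. norm (f p - g p :: 'a))"
  by (rule Bochner_Integration.integrable_bound[OF Bochner_Integration.integrable_add[OF assms(1,2)]])
     (use assms in \<open>auto intro!: AE_I2 norm_triangle_ineq4\<close>)

lemma integrable_joint_norm_diff:
  "integrable joint (\<lambda>(x, x', y, y'). norm (x - x'))"
  "integrable joint (\<lambda>(x, x', y, y'). norm (x - y))"
  "integrable joint (\<lambda>(x, x', y, y'). norm (x - y'))"
  "integrable joint (\<lambda>(x, x', y, y'). norm (x' - y))"
  "integrable joint (\<lambda>(x, x', y, y'). norm (y - y'))"
  unfolding case_prod_beta' by (intro integrable_norm_diff integrable_joint_norm; measurable)+

text \<open>The second factor is at most 1 in absolute value. Integrating that of the first over
  \<open>b\<close> gives \<open>\<bar>v \<bullet> (x - y)\<bar>\<close>, at most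
  \<open>norm v * norm (x - y)\<close>, which is integrable because the means are finite.\<close>

lemma integrable_slice_kernel:
  "integrable (joint \<Otimes>\<^sub>M lborel) (\<lambda>(p, b). slice_kernel b v p)"
proof -
  interpret pair_sigma_finite joint "lborel :: real measure" ..
  note bochner = has_bochner_integral_slice_kernel[of v]
  have meas [measurable]: "(\<lambda>(p, b). slice_kernel b v p) \<in> borel_measurable (joint \<Otimes>\<^sub>M lborel)"
    unfolding slice_kernel_def indicator_def atLeast_iff case_prod_beta' by measurable
  show ?thesis
  proof (rule Fubini_integrable)
    show "integrable joint (\<lambda>p. \<integral>b. norm (case (p, b) of (p, b) \<Rightarrow> slice_kernel b v p) \<partial>lborel)"
    proof (rule Bochner_Integration.integrable_bound)
      show "integrable joint (\<lambda>p. norm v * (case p of (x, x', y, y') \<Rightarrow> norm (x - y)))"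
        by (intro integrable_mult_right integrable_joint_norm_diff)
      have "norm (\<integral>b. norm (slice_kernel b v p) \<partial>lborel) \<le>
          norm (norm v * (case p of (x, x', y, y') \<Rightarrow> norm (x - y)))" for p
      proof -
        obtain x x' y y' where p: "p = (x, x', y, y')" by (cases p)
        have "(\<integral>b. norm (slice_kernel b v p) \<partial>lborel) \<le>
            (\<integral>b. \<bar>indicat_real {b..} (v \<bullet> x) - indicat_real {b..} (v \<bullet> y)\<bar> \<partial>lborel)"
        proof (rule integral_mono)
          show "integrable lborel (\<lambda>b. norm (slice_kernel b v p))"
            using bochner[of p] by (auto simp: has_bochner_integral_iff)
          show "integrable lborel (\<lambda>b. \<bar>indicat_real {b..} (v \<bullet> x) - indicat_real {b..} (v \<bullet> y)\<bar>)"
            using has_bochner_integral_half_line_abs_diff by (auto simp: has_bochner_integral_iff)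
        qed (auto simp: p slice_kernel_def indicator_def)
        also have "\<dots> = \<bar>v \<bullet> x - v \<bullet> y\<bar>"
          using has_bochner_integral_half_line_abs_diff by (rule has_bochner_integral_integral_eq)
        also have "\<dots> \<le> norm v * norm (x - y)"
          by (metis Cauchy_Schwarz_ineq2 inner_diff_right)
        finally show ?thesis by (simp add: p)
      qed
      then show "AE p in joint. norm (\<integral>b. norm (case (p, b) of (p, b) \<Rightarrow> slice_kernel b v p) \<partial>lborel) \<le>
          norm (norm v * (case p of (x, x', y, y') \<Rightarrow> norm (x - y)))"
        by simp
    qed measurable
    show "AE p in joint. integrable lborel (\<lambda>b. case (p, b) of (p, b) \<Rightarrow> slice_kernel b v p)"
      using bochner by (auto simp: has_bochner_integral_iff)
  qed measurable
qed

text \<open>Fubini exchanges the offset with the random points. Nonnegativity is not visible from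
  \<open>projected_energy\<close>, which can be negative pointwise; it holds because the other order
  of integration integrates squares.\<close>

lemma nn_integral_slice:
  "(\<integral>\<^sup>+ b. ennreal ((measure \<mu> {x. v \<bullet> x \<ge> b} - measure \<nu> {x. v \<bullet> x \<ge> b})\<^sup>2) \<partial>lborel) =
    ennreal (\<integral>p. projected_energy v p \<partial>joint)" (is "?L = ?R")
  and integral_projected_energy_nonneg: "0 \<le> (\<integral>p. projected_energy v p \<partial>joint)"
proof -
  interpret pair_sigma_finite joint "lborel :: real measure" ..
  have eq: "(\<integral>b. (\<integral>p. slice_kernel b v p \<partial>joint) \<partial>lborel) = (\<integral>p. projected_energy v p \<partial>joint)"
    using Fubini_integral[OF integrable_slice_kernel[of v]]
    by (simp add: has_bochner_integral_slice_kernel[THEN has_bochner_integral_integral_eq])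
  have "?L = (\<integral>\<^sup>+ b. ennreal (\<integral>p. slice_kernel b v p \<partial>joint) \<partial>lborel)"
    by (simp add: integral_slice_kernel)
  also have "\<dots> = ennreal (\<integral>b. (\<integral>p. slice_kernel b v p \<partial>joint) \<partial>lborel)"
    using integrable_snd[OF integrable_slice_kernel[of v]]
    by (intro nn_integral_eq_integral) (auto simp: integral_slice_kernel)
  finally show "?L = ?R" by (simp only: eq)
  have "0 \<le> (\<integral>b. (\<integral>p. slice_kernel b v p \<partial>joint) \<partial>lborel)"
    by (intro integral_nonneg_AE) (simp add: integral_slice_kernel)
  then show "0 \<le> (\<integral>p. projected_energy v p \<partial>joint)" by (simp only: eq)
qed

section \<open>Integration over the directions\<close>

text \<open>Integrating over \<open>v\<close> first leaves a constant multiple of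
  \<open>norm (f p)\<close>, so joint integrability follows from that of the norm.\<close>

lemma integrable_sphere_joint_abs_inner:
  assumes [measurable]: "f \<in> joint \<rightarrow>\<^sub>M (borel :: 'a measure)" and int: "integrable joint (\<lambda>p. norm (f p))"
  shows "integrable (joint \<Otimes>\<^sub>M sphere_measure) (\<lambda>(p, v). \<bar>v \<bullet> f p\<bar>)"
proof -
  interpret S: finite_measure "sphere_measure :: 'a measure" by (rule finite_measure_sphere_measure)
  interpret pair_sigma_finite joint "sphere_measure :: 'a measure" ..
  show ?thesis
  proof (rule Fubini_integrable)
    show "integrable joint (\<lambda>p. \<integral>v. norm (case (p, v) of (p, v) \<Rightarrow> \<bar>v \<bullet> f p\<bar>) \<partial>sphere_measure)"
      using has_bochner_integral_sphere_abs_inner[where 'a='a] int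
      by (simp add: has_bochner_integral_iff)
    show "AE p in joint. integrable sphere_measure (\<lambda>v. case (p, v) of (p, v) \<Rightarrow> \<bar>v \<bullet> f p\<bar>)"
      using has_bochner_integral_sphere_abs_inner[where 'a='a] by (simp add: has_bochner_integral_iff)
  qed measurable
qed

lemma integrable_projected_energy:
  "integrable (joint \<Otimes>\<^sub>M sphere_measure) (\<lambda>(p, v). projected_energy v p)"
proof -
  have *: "integrable (joint \<Otimes>\<^sub>M sphere_measure) (\<lambda>(p, v). \<bar>v \<bullet> (case p of (x, x', y, y') \<Rightarrow> x - x')\<bar>)"
    "integrable (joint \<Otimes>\<^sub>M sphere_measure) (\<lambda>(p, v). \<bar>v \<bullet> (case p of (x, x', y, y') \<Rightarrow> x - y')\<bar>)"
    "integrable (joint \<Otimes>\<^sub>M sphere_measure) (\<lambda>(p, v). \<bar>v \<bullet> (case p of (x, x', y, y') \<Rightarrow> x' - y)\<bar>)"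
    "integrable (joint \<Otimes>\<^sub>M sphere_measure) (\<lambda>(p, v). \<bar>v \<bullet> (case p of (x, x', y, y') \<Rightarrow> y - y')\<bar>)"
    using integrable_joint_norm_diff
    by (intro integrable_sphere_joint_abs_inner; simp add: case_prod_beta')+
  have "integrable (joint \<Otimes>\<^sub>M sphere_measure) (\<lambda>q.
      ((case q of (p, v) \<Rightarrow> \<bar>v \<bullet> (case p of (x, x', y, y') \<Rightarrow> x - y')\<bar>)
      + (case q of (p, v) \<Rightarrow> \<bar>v \<bullet> (case p of (x, x', y, y') \<Rightarrow> x' - y)\<bar>)
      - (case q of (p, v) \<Rightarrow> \<bar>v \<bullet> (case p of (x, x', y, y') \<Rightarrow> x - x')\<bar>)
      - (case q of (p, v) \<Rightarrow> \<bar>v \<bullet> (case p of (x, x', y, y') \<Rightarrow> y - y')\<bar>)) / 2)"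
    using * by (intro integrable_divide Bochner_Integration.integrable_diff Bochner_Integration.integrable_add)
  then show ?thesis
    by (simp add: projected_energy_def case_prod_beta')
qed

lemma integral_sphere_projected_energy:
  "(\<integral>v. projected_energy v (x, x', y, y') \<partial>sphere_measure) =
    sphere_const DIM('a) / 2 * (norm (x - y') + norm (x' - y) - norm (x - x') - norm (y - y'))"
proof -
  note * = has_bochner_integral_sphere_abs_inner
  have "has_bochner_integral sphere_measure (\<lambda>v. projected_energy v (x, x', y, y'))
      ((sphere_const DIM('a) * norm (x - y') + sphere_const DIM('a) * norm (x' - y)
        - sphere_const DIM('a) * norm (x - x') - sphere_const DIM('a) * norm (y - y')) / 2)"
    unfolding projected_energy_def case_prod_conv
    by (intro has_bochner_integral_divide_zero has_bochner_integral_diff has_bochner_integral_add *)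
  then show ?thesis
    by (simp add: has_bochner_integral_integral_eq field_simps)
qed

definition energy :: real where
  "energy = (\<integral>(x, x', y, y'). 2 * norm (x - y) - norm (x - x') - norm (y - y') \<partial>joint)"

text \<open>The pairs \<open>(x, y')\<close>, \<open>(x', y)\<close> and \<open>(x, y)\<close> have
  the same law, so the two cross terms integrate to \<open>2 * norm (x - y)\<close>.\<close>

lemma energy_eq:
  "(\<integral>(x, x', y, y'). norm (x - y') + norm (x' - y) - norm (x - x') - norm (y - y') \<partial>joint) = energy"
proof -
  have g: "(\<lambda>p. norm (fst p - snd p)) \<in> borel_measurable (borel \<Otimes>\<^sub>M (borel :: 'a measure))"
    by measurable
  note ints = integrable_joint_norm_diff[unfolded case_prod_beta']
    and eqs = integral_joint[OF g, unfolded case_prod_beta' fst_conv snd_conv]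
  show ?thesis
    unfolding energy_def case_prod_beta' using ints by (simp add: eqs)
qed

text \<open>A second use of Fubini, now exchanging directions with random points. The right side is
  nonnegative because it integrates the nonnegative slices.\<close>

lemma nn_integral_perceptron:
  "(\<integral>\<^sup>+ v. (\<integral>\<^sup>+ b. ennreal ((measure \<mu> {x. v \<bullet> x \<ge> b} - measure \<nu> {x. v \<bullet> x \<ge> b})\<^sup>2) \<partial>lborel)
      \<partial>sphere_measure) = ennreal (sphere_const DIM('a) / 2 * energy)"
  and sphere_energy_nonneg: "0 \<le> sphere_const DIM('a) / 2 * energy"
proof -
  interpret S: finite_measure "sphere_measure :: 'a measure" by (rule finite_measure_sphere_measure)
  interpret pair_sigma_finite joint "sphere_measure :: 'a measure" ..
  note int = integrable_projected_energy
  have "(\<integral>v. (\<integral>p. projected_energy v p \<partial>joint) \<partial>sphere_measure) =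
      (\<integral>p. (\<integral>v. projected_energy v p \<partial>sphere_measure) \<partial>joint)"
    by (rule Fubini_integral[OF int])
  also have "\<dots> = (\<integral>p. sphere_const DIM('a) / 2 *
      (case p of (x, x', y, y') \<Rightarrow> norm (x - y') + norm (x' - y) - norm (x - x') - norm (y - y')) \<partial>joint)"
    by (intro Bochner_Integration.integral_cong) (auto simp: integral_sphere_projected_energy)
  also have "\<dots> = sphere_const DIM('a) / 2 * energy"
    by (subst integral_mult_right_zero) (simp only: energy_eq)
  finally have eq: "(\<integral>v. (\<integral>p. projected_energy v p \<partial>joint) \<partial>sphere_measure) = sphere_const DIM('a) / 2 * energy" .
  show "(\<integral>\<^sup>+ v. (\<integral>\<^sup>+ b. ennreal ((measure \<mu> {x. v \<bullet> x \<ge> b} - measure \<nu> {x. v \<bullet> x \<ge> b})\<^sup>2) \<partial>lborel)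
      \<partial>sphere_measure) = ennreal (sphere_const DIM('a) / 2 * energy)"
    unfolding nn_integral_slice eq[symmetric]
    using integrable_snd[OF int]
    by (intro nn_integral_eq_integral) (auto simp: integral_projected_energy_nonneg)
  show "0 \<le> sphere_const DIM('a) / 2 * energy"
    unfolding eq[symmetric] by (intro integral_nonneg_AE) (simp add: integral_projected_energy_nonneg)
qed

end

theorem theorem3:
  fixes \<mu> \<nu> :: "'a::euclidean_space measure"
  assumes "prob_space \<mu>" "sets \<mu> = sets borel" "integrable \<mu> norm"
    and "prob_space \<nu>" "sets \<nu> = sets borel" "integrable \<nu> norm"
  shows "perceptron_discrepancy \<mu> \<nu> =
    ereal (pi powr ((real DIM('a) - 1) / 4) / sqrt (Gamma ((real DIM('a) + 1) / 2))
           * energy_distance \<mu> \<nu>)"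
proof -
  interpret distribution_pair \<mu> \<nu>
    using assms by (simp add: distribution_pair_def distribution_pair_axioms_def)
  have "sqrt (pi powr ((real DIM('a) - 1) / 2)) = pi powr ((real DIM('a) - 1) / 4)"
    by (simp add: powr_half_sqrt[symmetric] powr_powr)
  \<comment> \<open>\<open>sphere_const DIM('a) / 2\<close> is the square of the claimed prefactor;
    the root halves the exponent of \<open>pi\<close>.\<close>
  then have "sqrt (sphere_const DIM('a) / 2 * energy) =
      pi powr ((real DIM('a) - 1) / 4) / sqrt (Gamma ((real DIM('a) + 1) / 2)) * energy_distance \<mu> \<nu>"
    by (simp add: sphere_const_def energy_distance_def energy_def real_sqrt_mult real_sqrt_divide)
  then show ?thesis
    \<comment> \<open>The integral is an \<open>ennreal\<close> of a real, which rules out the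
      infinite branch; nonnegativity lets \<open>enn2real\<close> recover that real.\<close>
    using sphere_energy_nonneg
    by (simp add: perceptron_discrepancy_def nn_integral_perceptron Let_def)
qed

end
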